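(* Let $I$ be a finite set of items with sizes $c_i\in\mathbb{Z}_{\ge0}$, let $B\ge0$, and let $f:2^I\to\mathbb{R}_{\ge0}$ be a submodular function with $f(\emptyset)=0$ (not necessarily monotone). Let $\alpha\ge1$ and suppose an algorithm is available which, given any set $S$, returns $T\subseteq S$ with $f(T)\ge\frac1\alpha\max_{T'\subseteq S}f(T')$. Then there is a $(4+\alpha)$-approximation algorithm for maximizing $f(S)$ subject to $\sum_{i\in S}c_i\le B$, i.e., an algorithm returning a set $S$ with $\sum_{i\in S}c_i\le B$ and $f(S)\ge\frac{1}{4+\alpha}\max\{f(C): \sum_{i\in C}c_i\le B\}$.
   Context: A function $f$ is submodular if $f(A)+f(B)\ge f(A\cup B)+f(A\cap B)$ for all $A,B$. *)

theory Defs
  imports Complex_Main "HOL-Computational_Algebra.Polynomial"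
begin

definition submodular_on :: "'a set \<Rightarrow> ('a set \<Rightarrow> real) \<Rightarrow> bool" where
  "submodular_on I f \<longleftrightarrow>
     (\<forall>X Y. X \<subseteq> I \<longrightarrow> Y \<subseteq> I \<longrightarrow> f X + f Y \<ge> f (X \<union> Y) + f (X \<inter> Y))"

definition unconstrained_approx ::
  "real \<Rightarrow> 'a set \<Rightarrow> ('a set \<Rightarrow> real) \<Rightarrow> ('a set \<Rightarrow> 'a set) \<Rightarrow> bool" where
  "unconstrained_approx \<alpha> I f U \<longleftrightarrow>
     (\<forall>S \<subseteq> I. U S \<subseteq> S \<and> f (U S) \<ge> 1 / \<alpha> * Max (f ` Pow S))"

definition feasible_sets :: "'a set \<Rightarrow> ('a \<Rightarrow> nat) \<Rightarrow> real \<Rightarrow> 'a set set" where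
  "feasible_sets I c B = {S. S \<subseteq> I \<and> real (\<Sum>i\<in>S. c i) \<le> B}"

text \<open>
  Without a notion of computation the existence of an approximation algorithm is vacuous, since
  one could output an optimal set.  Algorithms are therefore programs of a while language with
  registers for sets of items and for numbers.  A program is a finite text that does not mention
  the instance; it has access to \<open>f\<close> through \<open>Val\<close> (value oracle) and to the given algorithm for
  unconstrained maximization through \<open>Unc\<close> (black box).

  Every executed command or test costs one step, an oracle call included.  The other primitives
  on sets and numbers take time polynomial in the number of items and in the bit length of the
  numbers.  To keep it so, products of numbers can be compared but not stored: in this way the
  values in registers are integer combinations of input numbers and oracle answers whose
  coefficients have bit length polynomial in the number of items and of executed steps.
\<close>

datatype sexp =
    SReg nat
  | Empty
  | Items
  | Union sexp sexp
  | Inter sexp sexp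
  | Diff sexp sexp
  | First sexp
  | Unc sexp

datatype nexp =
    NReg nat
  | Const int
  | Capacity
  | Size sexp
  | Val sexp
  | Plus nexp nexp
  | Minus nexp nexp

datatype test =
    Subset sexp sexp
  | Leq nexp nexp
  | LeqProd nexp nexp nexp nexp
  | Neg test
  | Conj test test

datatype prog =
    Skip
  | SetAssign nat sexp
  | NumAssign nat nexp
  | Seq prog prog
  | Cond test prog prog
  | While test prog

record 'a inst =
  items :: "'a set"
  size_of :: "'a \<Rightarrow> nat"
  capacity :: real
  val_oracle :: "'a set \<Rightarrow> real"
  unc_oracle :: "'a set \<Rightarrow> 'a set"

type_synonym 'a state = "(nat \<Rightarrow> 'a set) \<times> (nat \<Rightarrow> real)"

text \<open>
  The linear order on items is only the order in which a program enumerates them: \<open>First\<close> yields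
  the singleton of the least element (and the empty set on the empty set), so items are handled
  as singletons.
\<close>

fun seval :: "('a::linorder) inst \<Rightarrow> 'a state \<Rightarrow> sexp \<Rightarrow> 'a set" where
  "seval E s (SReg k) = fst s k"
| "seval E s Empty = {}"
| "seval E s Items = items E"
| "seval E s (Union a b) = seval E s a \<union> seval E s b"
| "seval E s (Inter a b) = seval E s a \<inter> seval E s b"
| "seval E s (Diff a b) = seval E s a - seval E s b"
| "seval E s (First a) = (if seval E s a = {} then {} else {Min (seval E s a)})"
| "seval E s (Unc a) = unc_oracle E (seval E s a)"

fun neval :: "('a::linorder) inst \<Rightarrow> 'a state \<Rightarrow> nexp \<Rightarrow> real" where
  "neval E s (NReg k) = snd s k"
| "neval E s (Const z) = of_int z"
| "neval E s Capacity = capacity E"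
| "neval E s (Size a) = real (\<Sum>i\<in>seval E s a. size_of E i)"
| "neval E s (Val a) = val_oracle E (seval E s a)"
| "neval E s (Plus x y) = neval E s x + neval E s y"
| "neval E s (Minus x y) = neval E s x - neval E s y"

fun teval :: "('a::linorder) inst \<Rightarrow> 'a state \<Rightarrow> test \<Rightarrow> bool" where
  "teval E s (Subset a b) \<longleftrightarrow> seval E s a \<subseteq> seval E s b"
| "teval E s (Leq x y) \<longleftrightarrow> neval E s x \<le> neval E s y"
| "teval E s (LeqProd x y x' y') \<longleftrightarrow>
     neval E s x * neval E s y \<le> neval E s x' * neval E s y'"
| "teval E s (Neg t) \<longleftrightarrow> \<not> teval E s t"
| "teval E s (Conj t u) \<longleftrightarrow> teval E s t \<and> teval E s u"

text \<open>\<open>exec E p s n t\<close>: started in state \<open>s\<close>, program \<open>p\<close> halts after \<open>n\<close> steps in state \<open>t\<close>.\<close>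

inductive exec ::
  "('a::linorder) inst \<Rightarrow> prog \<Rightarrow> 'a state \<Rightarrow> nat \<Rightarrow> 'a state \<Rightarrow> bool" for E where
  Skip: "exec E Skip s 1 s"
| SetAssign: "exec E (SetAssign k a) s 1 ((fst s)(k := seval E s a), snd s)"
| NumAssign: "exec E (NumAssign k x) s 1 (fst s, (snd s)(k := neval E s x))"
| Seq: "exec E p s m s' \<Longrightarrow> exec E q s' n s'' \<Longrightarrow> exec E (Seq p q) s (m + n) s''"
| CondTrue: "teval E s b \<Longrightarrow> exec E p s n s' \<Longrightarrow> exec E (Cond b p q) s (n + 1) s'"
| CondFalse: "\<not> teval E s b \<Longrightarrow> exec E q s n s' \<Longrightarrow> exec E (Cond b p q) s (n + 1) s'"
| WhileFalse: "\<not> teval E s b \<Longrightarrow> exec E (While b p) s 1 s"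
| WhileTrue: "teval E s b \<Longrightarrow> exec E p s m s' \<Longrightarrow> exec E (While b p) s' n s'' \<Longrightarrow>
    exec E (While b p) s (m + n + 1) s''"

inductive_cases Skip_elim: "exec E Skip s n t"
inductive_cases SetAssign_elim: "exec E (SetAssign k a) s n t"
inductive_cases NumAssign_elim: "exec E (NumAssign k x) s n t"
inductive_cases Seq_elim: "exec E (Seq p q) s n t"
inductive_cases Cond_elim: "exec E (Cond b p q) s n t"
inductive_cases While_elim: "exec E (While b p) s n t"

lemma exec_deterministic:
  "exec E p s m t \<Longrightarrow> exec E p s n u \<Longrightarrow> m = n \<and> t = u"
proof (induction arbitrary: n u rule: exec.induct)
  case (Skip s)
  then show ?case by (rule Skip_elim) simp
next
  case (SetAssign s k a)
  then show ?case by (rule SetAssign_elim) simp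
next
  case (NumAssign s k x)
  then show ?case by (rule NumAssign_elim) simp
next
  case (Seq p s m s' q n1 s'')
  from Seq.prems show ?case
  proof (rule Seq_elim)
    fix i j r
    assume n: "n = i + j" and p: "exec E p s i r" and q: "exec E q r j u"
    from Seq.IH(1)[OF p] have r: "m = i" "s' = r" by auto
    from q have "exec E q s' j u" unfolding r .
    from Seq.IH(2)[OF this] r n show ?thesis by simp
  qed
next
  case (CondTrue s b p n1 s' q)
  from CondTrue.prems show ?case
  proof (rule Cond_elim)
    fix i
    assume "n = Suc i" "exec E p s i u"
    with CondTrue.IH show ?thesis by auto
  next
    assume "\<not> teval E s b"
    with CondTrue.hyps show ?thesis by simp
  qed
next
  case (CondFalse s b q n1 s' p)
  from CondFalse.prems show ?case
  proof (rule Cond_elim)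
    assume "teval E s b"
    with CondFalse.hyps show ?thesis by simp
  next
    fix i
    assume "n = Suc i" "exec E q s i u"
    with CondFalse.IH show ?thesis by auto
  qed
next
  case (WhileFalse s b p)
  from WhileFalse.prems show ?case
  proof (rule While_elim)
    assume "n = Suc 0" "u = s"
    then show ?thesis by simp
  next
    assume "teval E s b"
    with WhileFalse.hyps show ?thesis by simp
  qed
next
  case (WhileTrue s b p m s' n1 s'')
  from WhileTrue.prems show ?case
  proof (rule While_elim)
    assume "\<not> teval E s b"
    with WhileTrue.hyps(1) show ?thesis by simp
  next
    fix i r j
    assume n: "n = Suc (i + j)" and p: "exec E p s i r" and q: "exec E (While b p) r j u"
    from WhileTrue.IH(1)[OF p] have r: "m = i" "s' = r" by auto
    from q have "exec E (While b p) s' j u" unfolding r .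
    from WhileTrue.IH(2)[OF this] r n show ?thesis by simp
  qed
qed

text \<open>
  \<open>halts_with E p n S\<close>: on instance \<open>E\<close>, started with all registers cleared, \<open>p\<close> halts after
  \<open>n\<close> steps and returns \<open>S\<close>, the content of set register \<open>0\<close>.
\<close>

definition halts_with ::
  "('a::linorder) inst \<Rightarrow> prog \<Rightarrow> nat \<Rightarrow> 'a set \<Rightarrow> bool" where
  "halts_with E p n S \<longleftrightarrow> (\<exists>t. exec E p (\<lambda>_. {}, \<lambda>_. 0) n t \<and> fst t 0 = S)"

end

theory Submission
  imports Defs
begin

text \<open>
  Let \<open>C\<close> be an optimal set and \<open>a\<close> an item of \<open>C\<close> of largest value \<open>f {a}\<close>.  Starting from
  \<open>{a}\<close>, the density greedy algorithm on the items of value at most \<open>f {a}\<close> stops with a set \<open>S\<close>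
  either because no gain is positive or because the next item \<open>e\<close> does not fit.  In the second
  case \<open>C - {a}\<close> is cheaper than \<open>S - {a}\<close> and \<open>e\<close> together, so that density gives
  \<open>f (S \<union> C) - f S \<le> f (insert e S) - f {a} \<le> f S\<close>, the last step since \<open>e\<close> gains at most
  \<open>f {e} \<le> f {a}\<close>.  Thus \<open>f (S \<union> C) \<le> 2 * f S\<close> in both cases.

  Trying all \<open>a\<close> yields such an \<open>S\<close>, and repeating this for \<open>C - S\<close> outside \<open>S\<close> yields a set \<open>T\<close>
  disjoint from \<open>S\<close> with \<open>f (T \<union> (C - S)) \<le> 2 * f T\<close>.  By submodularity and nonnegativity,
  \<open>f C \<le> f (S \<union> C) + f (T \<union> (C - S)) + f (C \<inter> S)\<close>, and the unconstrained algorithm applied to \<open>S\<close>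
  takes care of the last summand.
\<close>

section \<open>Total correctness with step bounds\<close>

text \<open>Since \<open>exec\<close> is deterministic, one halting run suffices for total
  correctness. The step count is only bounded from above, so bounds can be rounded up by
  \<open>runs_mono\<close>.\<close>

definition runs ::
  "('a::linorder) inst \<Rightarrow> prog \<Rightarrow> nat \<Rightarrow> 'a state \<Rightarrow> ('a state \<Rightarrow> bool) \<Rightarrow> bool" where
  "runs E p N s Q \<longleftrightarrow> (\<exists>n t. exec E p s n t \<and> n \<le> N \<and> Q t)"

lemma runs_mono:
  "runs E p M s P \<Longrightarrow> M \<le> N \<Longrightarrow> (\<And>t. P t \<Longrightarrow> Q t) \<Longrightarrow> runs E p N s Q"
  unfolding runs_def by (meson order_trans)

lemma runs_Skip: "Q s \<Longrightarrow> runs E Skip 1 s Q"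
  unfolding runs_def by (blast intro: exec.Skip)

lemma runs_SetAssign:
  "Q ((fst s)(k := seval E s a), snd s) \<Longrightarrow> runs E (SetAssign k a) 1 s Q"
  unfolding runs_def by (blast intro: exec.SetAssign)

lemma runs_Seq:
  assumes "runs E p M s (\<lambda>t. runs E q N t Q)"
  shows "runs E (Seq p q) (M + N) s Q"
  using assms unfolding runs_def by (meson add_mono exec.Seq)

lemma runs_SetAssign_Seq:
  assumes "runs E q N ((fst s)(k := seval E s a), snd s) Q"
  shows "runs E (Seq (SetAssign k a) q) (N + 1) s Q"
  using runs_Seq[OF runs_SetAssign, OF assms] by simp

lemma runs_Cond:
  assumes "teval E s b \<Longrightarrow> runs E p N s Q" "\<not> teval E s b \<Longrightarrow> runs E q N s Q"
  shows "runs E (Cond b p q) (N + 1) s Q"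
proof (cases "teval E s b")
  case True
  then obtain n t where "exec E p s n t" "n \<le> N" "Q t"
    using assms(1) unfolding runs_def by blast
  with True show ?thesis
    unfolding runs_def by (meson add_le_mono1 exec.CondTrue)
next
  case False
  then obtain n t where "exec E q s n t" "n \<le> N" "Q t"
    using assms(2) unfolding runs_def by blast
  with False show ?thesis
    unfolding runs_def by (meson add_le_mono1 exec.CondFalse)
qed

text \<open>\<open>V\<close> bounds the number of remaining iterations. Each costs at most
  \<open>N\<close> steps plus a successful test; the final \<open>1\<close> is the failing
  test.\<close>

lemma runs_While:
  fixes V :: "'a::linorder state \<Rightarrow> nat"
  assumes "J s"
    and body: "\<And>t. J t \<Longrightarrow> teval E t b \<Longrightarrow> runs E p N t (\<lambda>u. J u \<and> V u < V t)"
  shows "runs E (While b p) (V s * (N + 1) + 1) s (\<lambda>t. J t \<and> \<not> teval E t b)"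
  using assms(1)
proof (induction "V s" arbitrary: s rule: less_induct)
  case less
  show ?case
  proof (cases "teval E s b")
    case True
    obtain m u where m: "exec E p s m u" "m \<le> N" "J u" "V u < V s"
      using body[OF less.prems True] unfolding runs_def by blast
    obtain n t where n: "exec E (While b p) u n t" "n \<le> V u * (N + 1) + 1" "J t" "\<not> teval E t b"
      using less.hyps[OF m(4,3)] unfolding runs_def by blast
    have "m + n + 1 \<le> (V u + 1) * (N + 1) + 1" using m(2) n(2) by simp
    also have "\<dots> \<le> V s * (N + 1) + 1" using m(4) by (intro add_mono mult_right_mono) auto
    finally show ?thesis
      using exec.WhileTrue[OF True m(1) n(1)] n(3,4) unfolding runs_def by blast
  next
    case False
    then show ?thesis using exec.WhileFalse less.prems unfolding runs_def by fastforce
  qed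
qed

text \<open>A syntactic upper bound on the set registers that can change. Number registers are left
  out: the program below keeps its whole state in set registers.\<close>

fun writes :: "prog \<Rightarrow> nat set" where
  "writes Skip = {}"
| "writes (SetAssign k a) = {k}"
| "writes (NumAssign k x) = {}"
| "writes (Seq p q) = writes p \<union> writes q"
| "writes (Cond b p q) = writes p \<union> writes q"
| "writes (While b p) = writes p"

lemma exec_frame: "exec E p s n t \<Longrightarrow> k \<notin> writes p \<Longrightarrow> fst t k = fst s k"
  by (induction rule: exec.induct) auto

lemma runs_frame:
  "runs E p N s Q \<Longrightarrow> runs E p N s (\<lambda>t. Q t \<and> (\<forall>k. k \<notin> writes p \<longrightarrow> fst t k = fst s k))"
  unfolding runs_def using exec_frame by blast

text \<open>The item leaves \<open>y\<close> before the body runs, so for a body that does not write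
  \<open>y\<close> the cardinality of \<open>y\<close> is a loop variant.\<close>

definition foreach :: "nat \<Rightarrow> nat \<Rightarrow> prog \<Rightarrow> prog" where
  "foreach x y p = While (Neg (Subset (SReg y) Empty))
     (Seq (SetAssign x (First (SReg y))) (Seq (SetAssign y (Diff (SReg y) (SReg x))) p))"

lemma writes_foreach [simp]: "writes (foreach x y p) = insert x (insert y (writes p))"
  by (auto simp: foreach_def)

text \<open>The first argument of the invariant \<open>J\<close> is the set of items still to be visited.\<close>

lemma runs_foreach:
  fixes s :: "'a::linorder state"
  assumes fin: "finite (fst s y)" and xy: "x \<noteq> y" "y \<notin> writes p"
    and init: "J (fst s y) s"
    and step: "\<And>A e t. A \<subseteq> fst s y \<Longrightarrow> e \<in> A \<Longrightarrow> J A t \<Longrightarrow>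
      (\<And>k. k \<notin> writes (foreach x y p) \<Longrightarrow> fst t k = fst s k) \<Longrightarrow>
      runs E p N ((fst t)(x := {e}, y := A - {e}), snd t) (J (A - {e}))"
  shows "runs E (foreach x y p) (card (fst s y) * (N + 3) + 1) s (J {})"
proof -
  let ?J = "\<lambda>t. fst t y \<subseteq> fst s y \<and> J (fst t y) t \<and>
    (\<forall>k. k \<notin> insert x (insert y (writes p)) \<longrightarrow> fst t k = fst s k)"
  \<comment> \<open>Two assignments precede the body and one test precedes them, hence
    \<open>N + 3\<close> steps per item.\<close>
  have "runs E (foreach x y p) (card (fst s y) * ((N + 1 + 1) + 1) + 1) s
    (\<lambda>t. ?J t \<and> \<not> teval E t (Neg (Subset (SReg y) Empty)))"
    unfolding foreach_def[of x y p]
  proof (rule runs_While[where J = ?J and V = "\<lambda>t. card (fst t y)"])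
    fix t assume J: "?J t" and "teval E t (Neg (Subset (SReg y) Empty))"
    then have ne: "fst t y \<noteq> {}" by simp
    define e where "e = Min (fst t y)"
    have fint: "finite (fst t y)" using J fin finite_subset by blast
    have e: "e \<in> fst t y" using ne fint by (simp add: e_def)
    let ?t = "((fst t)(x := {e}, y := fst t y - {e}), snd t)"
    have "runs E p N ?t (J (fst t y - {e}))"
      using step[OF _ e] J by simp
    from runs_frame[OF this] have "runs E p N ?t
      (\<lambda>u. ?J u \<and> card (fst u y) < card (fst t y))"
    proof (rule runs_mono[OF _ order_refl])
      fix u assume u: "J (fst t y - {e}) u \<and> (\<forall>k. k \<notin> writes p \<longrightarrow> fst u k = fst ?t k)"
      then have uy: "fst u y = fst t y - {e}" using xy by simp
      have "card (fst u y) < card (fst t y)"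
        unfolding uy using fint e by (rule card_Diff1_less)
      then show "?J u \<and> card (fst u y) < card (fst t y)"
        using u J uy by auto
    qed
    then show "runs E (Seq (SetAssign x (First (SReg y))) (Seq (SetAssign y (Diff (SReg y) (SReg x))) p))
      (N + 1 + 1) t (\<lambda>u. ?J u \<and> card (fst u y) < card (fst t y))"
      using ne xy by (intro runs_SetAssign_Seq) (simp add: e_def)
  qed (use init in simp)
  then show ?thesis
    by (rule runs_mono) (auto simp: algebra_simps)
qed

section \<open>The algorithm\<close>

text \<open>
  Greedy phase: the allowed items are in set register 7, the singleton of the starting item in 8,
  the set built so far in 9, and the next item in 10 (empty if no gain is positive); 11 and 12
  belong to the search for the densest item.  With 10 empty the product test holds trivially.
\<close>

definition pick :: prog where
  "pick = Seq (SetAssign 11 (Diff (SReg 7) (SReg 9))) (Seq (SetAssign 10 Empty)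
     (foreach 12 11 (Cond
       (Conj (Conj (Leq (Val (SReg 12)) (Val (SReg 8)))
                   (Neg (Leq (Val (Union (SReg 9) (SReg 12))) (Val (SReg 9)))))
         (LeqProd (Size (SReg 12)) (Minus (Val (Union (SReg 9) (SReg 10))) (Val (SReg 9)))
                  (Size (SReg 10)) (Minus (Val (Union (SReg 9) (SReg 12))) (Val (SReg 9)))))
       (SetAssign 10 (SReg 12)) Skip)))"

definition greedy :: prog where
  "greedy = Seq (SetAssign 9 Empty) (Seq (SetAssign 10 (SReg 8))
     (While (Conj (Neg (Subset (SReg 10) Empty)) (Leq (Size (Union (SReg 9) (SReg 10))) Capacity))
       (Seq (SetAssign 9 (Union (SReg 9) (SReg 10))) pick)))"

text \<open>
  Register 0 holds the best set found so far, 2 and 5 the starting items of the first and second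
  greedy phase, 3 the set built in the first phase, and 1 and 4 the starting items still to try.
\<close>

definition keep :: "sexp \<Rightarrow> prog" where
  "keep a = Cond (Leq (Val (SReg 0)) (Val a)) (SetAssign 0 a) Skip"

definition second_phase :: prog where
  "second_phase = Seq (SetAssign 7 (Diff Items (SReg 3))) (Seq (SetAssign 8 (SReg 5))
     (Seq greedy (keep (SReg 9))))"

definition first_phase :: prog where
  "first_phase = Seq (SetAssign 7 Items) (Seq (SetAssign 8 (SReg 2)) (Seq greedy
     (Seq (SetAssign 3 (SReg 9)) (Seq (keep (SReg 3)) (Seq (keep (Unc (SReg 3)))
     (Seq (SetAssign 4 (Diff Items (SReg 3))) (foreach 5 4 second_phase)))))))"

definition knapsack_prog :: prog where
  "knapsack_prog = Seq (SetAssign 1 Items) (foreach 2 1 first_phase)"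

lemma writes_progs [simp]:
  "writes pick = {10, 11, 12}"
  "writes greedy = {9, 10, 11, 12}"
  "writes (keep a) = {0}"
  "writes second_phase = {0, 7, 8, 9, 10, 11, 12}"
  "writes first_phase = {0, 3, 4, 5, 7, 8, 9, 10, 11, 12}"
  by (auto simp: pick_def greedy_def keep_def second_phase_def first_phase_def)

section \<open>Correctness\<close>

locale knapsack =
  fixes I :: "'a::linorder set" and c :: "'a \<Rightarrow> nat" and B :: real
    and f :: "'a set \<Rightarrow> real" and U :: "'a set \<Rightarrow> 'a set" and \<alpha> :: real
  assumes fin: "finite I" and B: "B \<ge> 0" and nonneg: "\<And>S. S \<subseteq> I \<Longrightarrow> f S \<ge> 0"
    and submod: "submodular_on I f" and f_empty: "f {} = 0"
    and \<alpha>: "\<alpha> \<ge> 1" and U: "unconstrained_approx \<alpha> I f U"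
begin

abbreviation E :: "'a inst" where
  "E \<equiv> \<lparr>items = I, size_of = c, capacity = B, val_oracle = f, unc_oracle = U\<rparr>"

section \<open>Costs and marginal gains\<close>

definition cost :: "'a set \<Rightarrow> real" where
  "cost S = real (\<Sum>i\<in>S. c i)"

definition gain :: "'a set \<Rightarrow> 'a \<Rightarrow> real" where
  "gain S e = f (insert e S) - f S"

lemma finite_sub: "S \<subseteq> I \<Longrightarrow> finite S"
  using fin finite_subset by blast

lemma cost_insert: "S \<subseteq> I \<Longrightarrow> e \<notin> S \<Longrightarrow> cost (insert e S) = cost S + c e"
  by (simp add: cost_def finite_sub)

lemma cost_mono: "S \<subseteq> T \<Longrightarrow> T \<subseteq> I \<Longrightarrow> cost S \<le> cost T"
  unfolding cost_def by (metis finite_sub of_nat_le_iff sum_mono2 zero_le)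

lemma submodD: "X \<subseteq> I \<Longrightarrow> Y \<subseteq> I \<Longrightarrow> f (X \<union> Y) + f (X \<inter> Y) \<le> f X + f Y"
  using submod by (simp add: submodular_on_def)

text \<open>Submodularity as diminishing returns, from \<open>T\<close> and
  \<open>insert e S\<close>. The condition \<open>e \<notin> T\<close> matters because
  \<open>f\<close> need not be monotone: for \<open>e\<close> in \<open>T - S\<close> the left side
  is 0 while the right side may be negative.\<close>

lemma gain_antimono:
  assumes "S \<subseteq> T" "T \<subseteq> I" "e \<in> I" "e \<notin> T"
  shows "gain T e \<le> gain S e"
proof -
  have "T \<union> insert e S = insert e T" "T \<inter> insert e S = S" using assms by auto
  then have "f (insert e T) + f S \<le> f T + f (insert e S)"
    using submodD[of T "insert e S"] assms by auto
  then show ?thesis by (simp add: gain_def)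
qed

text \<open>Adding the items of \<open>C - S\<close> one at a time telescopes the left side, and
  each item gains at most what it would gain over \<open>S\<close> alone.\<close>

lemma union_le_sum_gain:
  assumes "S \<subseteq> I" "C \<subseteq> I"
  shows "f (S \<union> C) - f S \<le> (\<Sum>e\<in>C - S. gain S e)"
proof -
  have fin: "finite (C - S)" using assms finite_sub by blast
  have "X \<subseteq> C - S \<Longrightarrow> f (S \<union> X) - f S \<le> sum (gain S) X" if "finite X" for X
    using that
  proof (induction X rule: finite_induct)
    case (insert e X)
    then have "gain (S \<union> X) e \<le> gain S e" using assms by (intro gain_antimono) auto
    moreover have "f (S \<union> X) - f S \<le> sum (gain S) X" using insert by auto
    ultimately show ?case using insert by (simp add: gain_def)
  qed simp
  from this[OF fin] show ?thesis by simp
qed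

section \<open>Search for the densest candidate\<close>

definition candidates :: "'a set \<Rightarrow> 'a \<Rightarrow> 'a set \<Rightarrow> 'a set" where
  "candidates D a S = {e \<in> D - S. f {e} \<le> f {a} \<and> gain S e > 0}"

text \<open>Densities are compared by cross-multiplication since sizes may vanish.\<close>

definition densest :: "'a set \<Rightarrow> 'a set \<Rightarrow> 'a set \<Rightarrow> bool" where
  "densest S Z X \<longleftrightarrow> (if Z = {} then X = {} else
     \<exists>e\<in>Z. X = {e} \<and> (\<forall>z\<in>Z. c e * gain S z \<le> c z * gain S e))"

text \<open>One round of the search in \<open>pick\<close>. Comparing with the current best is
  enough because the density order is transitive; positive gains give this transitivity without
  dividing by sizes.\<close>

lemma densest_insert:
  assumes pos: "\<And>z. z \<in> insert e Z \<Longrightarrow> gain S z > 0" and X: "densest S Z X"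
  shows "densest S (insert e Z)
    (if c e * (f (S \<union> X) - f S) \<le> cost X * gain S e then {e} else X)"
proof (cases "Z = {}")
  case True
  then show ?thesis using X by (simp add: densest_def cost_def)
next
  case False
  then obtain d where d: "d \<in> Z" "X = {d}" and best: "\<And>z. z \<in> Z \<Longrightarrow> c d * gain S z \<le> c z * gain S d"
    using X by (auto simp: densest_def)
  have X': "f (S \<union> X) - f S = gain S d" "cost X = c d" by (simp_all add: d gain_def cost_def)
  show ?thesis
  proof (cases "c e * gain S d \<le> c d * gain S e")
    case True
    have "c e * gain S z \<le> c z * gain S e" if "z \<in> Z" for z
    proof -
      \<comment> \<open>Both comparisons are scaled by positive gains and chained through
        \<open>d\<close>; the factor \<open>gain S d\<close> cancels at the end.\<close>
      have "(c e * gain S z) * gain S d \<le> (c d * gain S z) * gain S e"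
        using mult_right_mono[OF True, of "gain S z"] pos[of z] that by (simp add: mult_ac)
      also have "\<dots> \<le> (c z * gain S d) * gain S e"
        using mult_right_mono[OF best[OF that], of "gain S e"] pos[of e] by simp
      finally have "(c e * gain S z) * gain S d \<le> (c z * gain S e) * gain S d"
        by (simp add: mult_ac)
      then show ?thesis using pos[of d] d by simp
    qed
    then show ?thesis using True unfolding X' by (auto simp: densest_def)
  next
    case False
    then show ?thesis using d best unfolding X' by (auto simp: densest_def)
  qed
qed

lemma runs_pick:
  fixes s :: "'a state"
  assumes D: "fst s 7 \<subseteq> I" and a: "fst s 8 = {a}"
  shows "runs E pick (5 * card I + 3) s
    (\<lambda>t. densest (fst s 9) (candidates (fst s 7) a (fst s 9)) (fst t 10))"
proof -
  define D S where "D = fst s 7" and "S = fst s 9"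
  let ?s = "((fst s)(11 := D - S, 10 := {}), snd s)"
  \<comment> \<open>\<open>A\<close> holds the unvisited items, so register 10 is the densest among
    the candidates already seen.\<close>
  define J where "J A t = densest S (candidates D a S - A) (fst t 10)" for A and t :: "'a state"
  have finD: "finite (D - S)" using D finite_sub by (auto simp: D_def)
  let ?b = "Conj (Conj (Leq (Val (SReg 12)) (Val (SReg 8)))
                (Neg (Leq (Val (Union (SReg 9) (SReg 12))) (Val (SReg 9)))))
      (LeqProd (Size (SReg 12)) (Minus (Val (Union (SReg 9) (SReg 10))) (Val (SReg 9)))
               (Size (SReg 10)) (Minus (Val (Union (SReg 9) (SReg 12))) (Val (SReg 9))))"
  let ?p = "Cond ?b (SetAssign 10 (SReg 12)) Skip"
  have "runs E (foreach 12 11 ?p) (card (fst ?s 11) * ((1 + 1) + 3) + 1) ?s (J {})"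
  proof (rule runs_foreach)
    show "J (fst ?s 11) ?s"
    proof -
      have "candidates D a S - (D - S) = {}" by (auto simp: candidates_def)
      then show ?thesis by (simp add: J_def densest_def)
    qed
  next
    fix A e and t :: "'a state"
    assume A: "A \<subseteq> fst ?s 11" "e \<in> A" and J: "J A t"
      and fr: "\<And>k. k \<notin> writes (foreach 12 11 ?p) \<Longrightarrow> fst t k = fst ?s k"
    have regs: "fst t 8 = {a}" "fst t 9 = S" using fr a by (auto simp: S_def)
    have eDS: "e \<in> D - S" using A by auto
    let ?t = "((fst t)(12 := {e}, 11 := A - {e}), snd t)"
    let ?X = "fst t 10"
    \<comment> \<open>A failing test can mean that \<open>e\<close> is no candidate or that it is
      less dense than the current best, so the cases follow candidacy instead of the test.\<close>
    have notcand: "J (A - {e}) u"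
      if "e \<notin> candidates D a S" "fst u 10 = ?X" for u :: "'a state"
    proof -
      have "candidates D a S - (A - {e}) = candidates D a S - A" using that by auto
      then show ?thesis using J that by (simp add: J_def)
    qed
    have cand: "J (A - {e}) u"
      if "e \<in> candidates D a S"
        "fst u 10 = (if c e * (f (S \<union> ?X) - f S) \<le> cost ?X * gain S e then {e} else ?X)"
      for u :: "'a state"
    proof -
      have "candidates D a S - (A - {e}) = insert e (candidates D a S - A)" using that by auto
      moreover have "densest S (insert e (candidates D a S - A)) (fst u 10)"
        unfolding that(2)
        by (rule densest_insert) (use that(1) J in \<open>auto simp: candidates_def J_def\<close>)
      ultimately show ?thesis by (simp add: J_def)
    qed
    show "runs E ?p (1 + 1) ?t (J (A - {e}))"
    proof (rule runs_Cond; (rule runs_SetAssign | rule runs_Skip))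
      assume "teval E ?t ?b"
      then show "J (A - {e}) ((fst ?t)(10 := seval E ?t (SReg 12)), snd ?t)"
        using eDS by (intro cand) (auto simp: regs candidates_def gain_def cost_def)
    next
      assume no: "\<not> teval E ?t ?b"
      show "J (A - {e}) ?t"
      proof (cases "e \<in> candidates D a S")
        case True
        then show ?thesis
          using no by (intro cand) (auto simp: regs candidates_def gain_def cost_def)
      qed (simp add: notcand)
    qed
  qed (use finD in auto)
  then have run: "runs E pick (card (D - S) * ((1 + 1) + 3) + 1 + 1 + 1) s (J {})"
    unfolding pick_def by (intro runs_SetAssign_Seq) (simp add: D_def S_def)
  have "card (D - S) \<le> card I"
    using D fin by (intro card_mono) (auto simp: D_def)
  then show ?thesis
    by (intro runs_mono[OF run]) (auto simp: J_def D_def S_def)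
qed

section \<open>The greedy phase: invariant, quality and running time\<close>

text \<open>
  The last conjunct says that no candidate is denser, with respect to \<open>S\<close>, than \<open>S - {a}\<close> is on
  average with respect to \<open>{a}\<close>.
\<close>

definition greedy_inv :: "'a set \<Rightarrow> 'a \<Rightarrow> 'a set \<Rightarrow> bool" where
  "greedy_inv D a S \<longleftrightarrow> a \<in> S \<and> S \<subseteq> D \<and>
     (\<forall>e\<in>candidates D a S. (cost S - c a) * gain S e \<le> (f S - f {a}) * c e)"

lemma greedy_inv_singleton: "a \<in> D \<Longrightarrow> greedy_inv D a {a}"
  by (simp add: greedy_inv_def cost_def)

text \<open>Gains only shrink when \<open>x\<close> is added, so every new candidate
  \<open>e\<close> was one before. The part \<open>cost S - c a\<close> of the new cost is paid for
  by the old invariant, the part \<open>c x\<close> by the choice of \<open>x\<close> as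
  densest.\<close>

lemma greedy_inv_insert:
  assumes D: "D \<subseteq> I" and inv: "greedy_inv D a S"
    and x: "x \<in> candidates D a S"
    and best: "\<And>e. e \<in> candidates D a S \<Longrightarrow> c x * gain S e \<le> c e * gain S x"
  shows "greedy_inv D a (insert x S)"
proof -
  have S: "a \<in> S" "S \<subseteq> D" "x \<in> D" "x \<notin> S" using inv x by (auto simp: greedy_inv_def candidates_def)
  have "(cost (insert x S) - c a) * gain (insert x S) e \<le> (f (insert x S) - f {a}) * c e"
    if e: "e \<in> candidates D a (insert x S)" for e
  proof -
    have le: "gain (insert x S) e \<le> gain S e"
      using e S D by (intro gain_antimono) (auto simp: candidates_def)
    then have e': "e \<in> candidates D a S" using e by (auto simp: candidates_def)
    have "c a \<le> cost S" using cost_mono[of "{a}" S] S D by (auto simp: cost_def)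
    have ci: "cost (insert x S) = cost S + c x" using S D by (intro cost_insert) auto
    have "(cost (insert x S) - c a) * gain (insert x S) e \<le> (cost S - c a + c x) * gain S e"
      unfolding ci using le \<open>c a \<le> cost S\<close> by (intro mult_mono) (use e in \<open>auto simp: candidates_def\<close>)
    also have "\<dots> \<le> (f S - f {a}) * c e + c e * gain S x"
      using best[OF e'] inv e' by (auto simp: greedy_inv_def distrib_right)
    also have "\<dots> = (f (insert x S) - f {a}) * c e" by (simp add: gain_def algebra_simps)
    finally show ?thesis .
  qed
  then show ?thesis using S by (auto simp: greedy_inv_def)
qed

definition top_item :: "'a \<Rightarrow> 'a set \<Rightarrow> bool" where
  "top_item a C \<longleftrightarrow> a \<in> C \<and> (\<forall>e\<in>C. f {e} \<le> f {a})"

lemma ex_top_item: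
  assumes "C \<subseteq> I" "C \<noteq> {}"
  shows "\<exists>a. top_item a C"
proof -
  have fC: "finite ((\<lambda>e. f {e}) ` C)" using assms finite_sub by blast
  then have "Max ((\<lambda>e. f {e}) ` C) \<in> (\<lambda>e. f {e}) ` C" using assms by (intro Max_in) auto
  then obtain a where "a \<in> C" "f {a} = Max ((\<lambda>e. f {e}) ` C)" by auto
  then show ?thesis using fC unfolding top_item_def by (metis Max_ge imageI)
qed

lemma greedy_stop:
  assumes D: "D \<subseteq> I" and inv: "greedy_inv D a S" and cS: "cost S \<le> B"
    and X: "densest S (candidates D a S) X"
    and stop: "X = {} \<or> cost (S \<union> X) > B"
    and C: "C \<subseteq> D" "cost C \<le> B" "top_item a C"
  shows "f (S \<union> C) \<le> 2 * f S"
proof -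
  have S: "a \<in> S" "S \<subseteq> D" using inv by (auto simp: greedy_inv_def)
  have CI: "C \<subseteq> I" "S \<subseteq> I" using C D S by auto
  have sum: "f (S \<union> C) - f S \<le> (\<Sum>e\<in>C - S. gain S e)" using CI by (intro union_le_sum_gain)
  \<comment> \<open>As \<open>a\<close> is a top item of \<open>C\<close>, all of \<open>C\<close>
    respects the cap on \<open>f {e}\<close>; only a nonpositive gain can exclude an item of
    \<open>C - S\<close>.\<close>
  have cand: "e \<in> candidates D a S" if "e \<in> C - S" "gain S e > 0" for e
    using that C by (auto simp: candidates_def top_item_def)
  show ?thesis
  proof (cases "candidates D a S = {}")
    case True
    then have "(\<Sum>e\<in>C - S. gain S e) \<le> 0" using cand by (intro sum_nonpos) force
    then show ?thesis using sum nonneg[of S] CI by simp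
  next
    case False
    then obtain e where e: "e \<in> candidates D a S" "X = {e}"
      and best: "\<And>z. z \<in> candidates D a S \<Longrightarrow> c e * gain S z \<le> c z * gain S e"
      using X by (auto simp: densest_def)
    have e': "e \<in> I" "e \<notin> S" "gain S e > 0" "f {e} \<le> f {a}" using e D by (auto simp: candidates_def)
    have over: "cost S + c e > B" using stop e cost_insert[OF CI(2) e'(2)] by simp
    \<comment> \<open>An item that overflows the budget has positive size, so the final estimate can
      be divided by \<open>c e\<close>.\<close>
    then have ce: "real (c e) > 0" using cS by simp
    have "real (c e) * (f (S \<union> C) - f S) \<le> real (c e) * (\<Sum>z\<in>C - S. gain S z)"
      using sum by (intro mult_left_mono) auto
    also have "\<dots> \<le> (\<Sum>z\<in>C - S. c z * gain S e)"
      unfolding sum_distrib_left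
    proof (rule sum_mono)
      fix z assume z: "z \<in> C - S"
      show "c e * gain S z \<le> c z * gain S e"
      proof (cases "gain S z > 0")
        case True
        then show ?thesis using best cand[OF z] by blast
      next
        case False
        then have "c e * gain S z \<le> 0" by (simp add: mult_nonneg_nonpos)
        also have "0 \<le> c z * gain S e" using e' by simp
        finally show ?thesis .
      qed
    qed
    also have "\<dots> = cost (C - S) * gain S e" by (simp add: cost_def sum_distrib_right)
    \<comment> \<open>The item \<open>a\<close> lies in both \<open>C\<close> and \<open>S\<close>.
      Hence \<open>cost (C - S) + c a\<close> is at most \<open>cost C\<close>, which is at most
      \<open>B\<close> and so below \<open>cost S + c e\<close>.\<close>
    also have "\<dots> \<le> (cost S - c a + c e) * gain S e"
    proof (rule mult_right_mono)
      have aC: "a \<in> C" using C by (simp add: top_item_def)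
      have "cost (C - S) + c a = cost (insert a (C - S))"
        using CI S by (subst cost_insert) auto
      also have "\<dots> \<le> cost C" using CI aC by (intro cost_mono) auto
      finally show "cost (C - S) \<le> cost S - c a + c e" using C over by simp
    qed (use e' in simp)
    also have "\<dots> \<le> (f S - f {a}) * c e + c e * gain S e"
      using inv e by (auto simp: greedy_inv_def distrib_right)
    also have "\<dots> = real (c e) * (f S - f {a} + gain S e)" by (simp add: algebra_simps)
    finally have "f (S \<union> C) - f S \<le> f S - f {a} + gain S e" using ce by simp
    \<comment> \<open>The cap on candidates enters here: \<open>gain {} e\<close> is
      \<open>f {e}\<close>, at most \<open>f {a}\<close>, which cancels the subtracted
      \<open>f {a}\<close>.\<close>
    moreover have "gain S e \<le> gain {} e" using e' CI by (intro gain_antimono) auto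
    ultimately show ?thesis using e' f_empty by (simp add: gain_def)
  qed
qed

text \<open>Quantifying over all \<open>C\<close> with top item \<open>a\<close> makes this a
  property of a run that does not know the optimum. If \<open>{a}\<close> alone exceeds the budget,
  no such \<open>C\<close> exists and the empty set qualifies.\<close>

definition good_greedy :: "'a set \<Rightarrow> 'a \<Rightarrow> 'a set \<Rightarrow> bool" where
  "good_greedy D a S \<longleftrightarrow> S \<subseteq> D \<and> cost S \<le> B \<and>
     (\<forall>C\<subseteq>D. cost C \<le> B \<longrightarrow> top_item a C \<longrightarrow> f (S \<union> C) \<le> 2 * f S)"

text \<open>An iteration costs \<open>5 * card I + 3\<close> for \<open>pick\<close>, one assignment
  and one test; the last \<open>3\<close> is two initial assignments and the failing test.\<close>

definition greedy_time :: nat where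
  "greedy_time = card I * (5 * card I + 5) + 3"

lemma runs_greedy:
  fixes s :: "'a state"
  assumes D: "fst s 7 \<subseteq> I" and a: "fst s 8 = {a}" "a \<in> fst s 7"
  shows "runs E greedy greedy_time s (\<lambda>t. good_greedy (fst s 7) a (fst t 9))"
proof -
  define D where "D = fst s 7"
  have DI: "D \<subseteq> I" "a \<in> D" using assms by (auto simp: D_def)
  let ?b = "Conj (Neg (Subset (SReg 10) Empty)) (Leq (Size (Union (SReg 9) (SReg 10))) Capacity)"
  let ?s = "((fst s)(9 := {}, 10 := {a}), snd s)"
  \<comment> \<open>Before the first pass the set is empty and \<open>{a}\<close> is only pending,
    so \<open>greedy_inv\<close>, which demands \<open>a \<in> S\<close>, cannot hold yet.\<close>
  define J where "J t \<longleftrightarrow> fst t 7 = D \<and> fst t 8 = {a} \<and> cost (fst t 9) \<le> B \<and>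
    (fst t 9 = {} \<and> fst t 10 = {a} \<or>
     greedy_inv D a (fst t 9) \<and> densest (fst t 9) (candidates D a (fst t 9)) (fst t 10))"
    for t :: "'a state"
  have "runs E (While ?b (Seq (SetAssign 9 (Union (SReg 9) (SReg 10))) pick))
    (card (D - fst ?s 9) * ((5 * card I + 3 + 1) + 1) + 1) ?s (\<lambda>t. J t \<and> \<not> teval E t ?b)"
  proof (rule runs_While[where J = J and V = "\<lambda>t. card (D - fst t 9)"])
    show "J ?s" using a B by (simp add: J_def D_def cost_def)
  next
    fix t :: "'a state"
    assume J: "J t" and b: "teval E t ?b"
    define S X where "S = fst t 9" and "X = fst t 10"
    have XS: "X \<noteq> {}" "cost (S \<union> X) \<le> B" using b by (auto simp: S_def X_def cost_def)
    have inv: "greedy_inv D a (S \<union> X)" "X \<subseteq> D - S"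
    proof -
      from J consider "S = {}" "X = {a}" |
        "greedy_inv D a S" "densest S (candidates D a S) X"
        by (auto simp: J_def S_def X_def)
      then have "greedy_inv D a (S \<union> X) \<and> X \<subseteq> D - S"
      proof cases
        case 1
        then show ?thesis using greedy_inv_singleton DI by simp
      next
        case 2
        then have "candidates D a S \<noteq> {}" using XS by (auto simp: densest_def)
        then obtain e where e: "e \<in> candidates D a S" "X = {e}"
          and best: "\<And>z. z \<in> candidates D a S \<Longrightarrow> c e * gain S z \<le> c z * gain S e"
          using 2 by (auto simp: densest_def)
        then show ?thesis using greedy_inv_insert[OF DI(1) 2(1) e(1) best]
          by (auto simp: candidates_def)
      qed
      then show "greedy_inv D a (S \<union> X)" "X \<subseteq> D - S" by auto
    qed
    let ?t = "((fst t)(9 := S \<union> X), snd t)"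
    have "runs E pick (5 * card I + 3) ?t
      (\<lambda>u. densest (fst ?t 9) (candidates (fst ?t 7) a (fst ?t 9)) (fst u 10))"
      using J DI by (intro runs_pick) (auto simp: J_def)
    from runs_frame[OF this] have "runs E pick (5 * card I + 3) ?t
      (\<lambda>u. J u \<and> card (D - fst u 9) < card (D - fst t 9))"
    proof (rule runs_mono[OF _ order_refl])
      fix u :: "'a state"
      assume u: "densest (fst ?t 9) (candidates (fst ?t 7) a (fst ?t 9)) (fst u 10) \<and>
        (\<forall>k. k \<notin> writes pick \<longrightarrow> fst u k = fst ?t k)"
      have "D - (S \<union> X) \<subset> D - S" using XS inv by auto
      then have "card (D - (S \<union> X)) < card (D - S)"
        using DI finite_sub by (intro psubset_card_mono) auto
      then show "J u \<and> card (D - fst u 9) < card (D - fst t 9)"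
        using u J inv XS by (auto simp: J_def S_def X_def)
    qed
    then show "runs E (Seq (SetAssign 9 (Union (SReg 9) (SReg 10))) pick) (5 * card I + 3 + 1) t
      (\<lambda>u. J u \<and> card (D - fst u 9) < card (D - fst t 9))"
      by (intro runs_SetAssign_Seq) (simp add: S_def X_def)
  qed
  then have run: "runs E greedy (card D * (5 * card I + 3 + 1 + 1) + 1 + 1 + 1) s
    (\<lambda>t. J t \<and> \<not> teval E t ?b)"
    unfolding greedy_def using a by (intro runs_SetAssign_Seq) simp
  have "card D \<le> card I" using DI fin by (intro card_mono)
  then have "card D * (5 * card I + 3 + 1 + 1) \<le> card I * (5 * card I + 5)" by (intro mult_mono) auto
  then have "card D * (5 * card I + 3 + 1 + 1) + 1 + 1 + 1 \<le> greedy_time"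
    unfolding greedy_time_def by linarith
  moreover have "good_greedy D a (fst t 9)" if t: "J t" "\<not> teval E t ?b" for t :: "'a state"
  proof -
    define S X where "S = fst t 9" and "X = fst t 10"
    have stop: "X = {} \<or> cost (S \<union> X) > B" using t by (auto simp: S_def X_def cost_def)
    have cS: "cost S \<le> B" using t by (simp add: J_def S_def)
    from t consider "S = {}" "X = {a}" |
      "greedy_inv D a S" "densest S (candidates D a S) X"
      by (auto simp: J_def S_def X_def)
    then have "good_greedy D a S"
    proof cases
      case 1
      \<comment> \<open>Stopping at once means that \<open>{a}\<close> does not fit, and every
        \<open>C\<close> in question contains \<open>a\<close>.\<close>
      have "\<not> cost C \<le> B" if "C \<subseteq> D" "top_item a C" for C
        using cost_mono[OF _ order_trans[OF that(1) DI(1)], of "{a}"] that 1 stop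
        by (auto simp: top_item_def)
      then show ?thesis using 1 cS by (auto simp: good_greedy_def)
    next
      case 2
      then show ?thesis using greedy_stop[OF DI(1) 2(1) cS 2(2) stop] cS
        by (auto simp: good_greedy_def greedy_inv_def)
    qed
    then show ?thesis by (simp add: S_def)
  qed
  ultimately show ?thesis
    unfolding D_def[symmetric] by (intro runs_mono[OF run]) auto
qed

section \<open>The two nested phases and the best set kept\<close>

definition feasible :: "'a set \<Rightarrow> bool" where
  "feasible S \<longleftrightarrow> S \<subseteq> I \<and> cost S \<le> B"

lemma runs_keep:
  fixes s :: "'a state"
  shows "runs E (keep a) 2 s (\<lambda>t. (fst t 0 = fst s 0 \<or> fst t 0 = seval E s a) \<and>
    f (fst s 0) \<le> f (fst t 0) \<and> f (seval E s a) \<le> f (fst t 0))"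
proof -
  have "runs E (keep a) (1 + 1) s (\<lambda>t. (fst t 0 = fst s 0 \<or> fst t 0 = seval E s a) \<and>
    f (fst s 0) \<le> f (fst t 0) \<and> f (seval E s a) \<le> f (fst t 0))"
    unfolding keep_def by (rule runs_Cond; (rule runs_SetAssign | rule runs_Skip)) auto
  then show ?thesis by (simp add: numeral_2_eq_2)
qed

definition improved :: "'a state \<Rightarrow> 'a state \<Rightarrow> bool" where
  "improved s t \<longleftrightarrow> (feasible (fst s 0) \<longrightarrow> feasible (fst t 0)) \<and> f (fst s 0) \<le> f (fst t 0)"

lemma runs_second_phase:
  fixes s :: "'a state"
  assumes b: "fst s 5 = {b}" "b \<in> I - fst s 3"
  shows "runs E second_phase (greedy_time + 4) s (\<lambda>t. improved s t \<and>
    (\<exists>T. good_greedy (I - fst s 3) b T \<and> f T \<le> f (fst t 0)))"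
proof -
  let ?D = "I - fst s 3"
  let ?s = "((fst s)(7 := ?D, 8 := {b}), snd s)"
  let ?Q = "\<lambda>t. improved s t \<and> (\<exists>T. good_greedy ?D b T \<and> f T \<le> f (fst t 0))"
  have "runs E greedy greedy_time ?s (\<lambda>t. good_greedy (fst ?s 7) b (fst t 9))"
    using b by (intro runs_greedy) auto
  from runs_frame[OF this]
  have "runs E greedy greedy_time ?s (\<lambda>t. runs E (keep (SReg 9)) 2 t ?Q)"
  proof (rule runs_mono[OF _ order_refl])
    fix t :: "'a state"
    assume t: "good_greedy (fst ?s 7) b (fst t 9) \<and>
      (\<forall>k. k \<notin> writes greedy \<longrightarrow> fst t k = fst ?s k)"
    show "runs E (keep (SReg 9)) 2 t ?Q"
      by (rule runs_mono[OF runs_keep order_refl])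
        (use t in \<open>auto simp: improved_def feasible_def good_greedy_def\<close>)
  qed
  then have "runs E (Seq greedy (keep (SReg 9))) (greedy_time + 2) ?s ?Q"
    by (rule runs_Seq)
  then have "runs E second_phase (greedy_time + 2 + 1 + 1) s ?Q"
    unfolding second_phase_def using b by (intro runs_SetAssign_Seq) simp
  then show ?thesis by (rule runs_mono) auto
qed

lemma unc: "S \<subseteq> I \<Longrightarrow> U S \<subseteq> S"
  using U by (simp add: unconstrained_approx_def)

lemma unc_ge:
  assumes "S \<subseteq> I" "T \<subseteq> S"
  shows "f T \<le> \<alpha> * f (U S)"
proof -
  have "f T \<le> Max (f ` Pow S)" using assms finite_sub by (intro Max_ge) auto
  then have "1 / \<alpha> * f T \<le> 1 / \<alpha> * Max (f ` Pow S)" using \<alpha> by (intro mult_left_mono) auto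
  also have "\<dots> \<le> f (U S)" using U assms by (simp add: unconstrained_approx_def)
  finally show ?thesis using \<alpha> by (simp add: field_simps)
qed

text \<open>The constant comes from splitting \<open>C\<close>: the part inside \<open>S\<close>
  costs \<open>\<alpha> * r\<close> through the unconstrained algorithm, the part outside
  \<open>4 * r\<close>, namely \<open>2 * r\<close> for each greedy set. The assumption
  \<open>second\<close> covers every \<open>b\<close> because the top item of \<open>C - S\<close>
  is not known in advance.\<close>

lemma combine:
  assumes S: "good_greedy I a S" and C: "feasible C" "top_item a C"
    and R: "f S \<le> r" "f (U S) \<le> r" "r \<ge> 0"
    and second: "\<And>b. b \<in> I - S \<Longrightarrow> \<exists>T. good_greedy (I - S) b T \<and> f T \<le> r"
  shows "f C \<le> (4 + \<alpha>) * r"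
proof -
  have I: "S \<subseteq> I" "C \<subseteq> I" using S C by (auto simp: good_greedy_def feasible_def)
  have 1: "f (S \<union> C) \<le> 2 * f S" using S C by (auto simp: good_greedy_def feasible_def)
  have "f (C \<inter> S) \<le> \<alpha> * f (U S)" using I by (intro unc_ge) auto
  also have "\<dots> \<le> \<alpha> * r" using R \<alpha> by simp
  finally have 2: "f (C \<inter> S) \<le> \<alpha> * r" .
  have 3: "f (C - S) \<le> 4 * r"
  proof (cases "C - S = {}")
    case True
    then show ?thesis unfolding True using f_empty R by simp
  next
    case False
    then obtain b where b: "top_item b (C - S)" using ex_top_item[of "C - S"] I by blast
    then have "b \<in> I - S" using I by (auto simp: top_item_def)
    then obtain T where T: "good_greedy (I - S) b T" "f T \<le> r" using second by blast
    have TS: "T \<subseteq> I - S" using T by (simp add: good_greedy_def)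
    have "cost (C - S) \<le> B" using cost_mono[of "C - S" C] C by (auto simp: feasible_def)
    moreover have "C - S \<subseteq> I - S" using I by blast
    ultimately have "f (T \<union> (C - S)) \<le> 2 * f T" using T b unfolding good_greedy_def by blast
    \<comment> \<open>The two sets meet exactly in \<open>C - S\<close> because \<open>T\<close>
      avoids \<open>S\<close>; the value of their union is dropped by nonnegativity.\<close>
    moreover have "f ((S \<union> C) \<union> (T \<union> (C - S))) + f ((S \<union> C) \<inter> (T \<union> (C - S)))
        \<le> f (S \<union> C) + f (T \<union> (C - S))"
      using I TS by (intro submodD) auto
    moreover have "f ((S \<union> C) \<inter> (T \<union> (C - S))) = f (C - S)"
      using TS by (intro arg_cong[of _ _ f]) auto
    moreover have "f ((S \<union> C) \<union> (T \<union> (C - S))) \<ge> 0" using I TS by (intro nonneg) auto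
    ultimately show ?thesis using 1 R(1) T(2) by linarith
  qed
  have "C \<inter> S \<subseteq> I" "C - S \<subseteq> I" using I by auto
  from submodD[OF this] have "f C \<le> f (C \<inter> S) + f (C - S)"
    by (simp add: Int_Diff_Un Int_Diff_disjoint f_empty)
  then show ?thesis using 2 3 by (simp add: distrib_right)
qed

text \<open>Here \<open>7\<close> is 4 steps of \<open>second_phase\<close> around
  \<open>greedy\<close> plus 3 of loop overhead; \<open>9\<close> is four assignments, two
  \<open>keep\<close> of 2 steps each and the failing loop test.\<close>

definition first_phase_time :: nat where
  "first_phase_time = card I * (greedy_time + 7) + greedy_time + 9"

lemma runs_first_phase:
  fixes s :: "'a state"
  assumes a: "fst s 2 = {a}" "a \<in> I" and R: "feasible (fst s 0)"
  shows "runs E first_phase first_phase_time s (\<lambda>t. improved s t \<and>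
    (\<forall>C. feasible C \<longrightarrow> top_item a C \<longrightarrow> f C \<le> (4 + \<alpha>) * f (fst t 0)))"
proof -
  let ?Q = "\<lambda>t. improved s t \<and>
    (\<forall>C. feasible C \<longrightarrow> top_item a C \<longrightarrow> f C \<le> (4 + \<alpha>) * f (fst t 0))"
  let ?N = "card I * (greedy_time + 7) + 1"
  have loop: "runs E (foreach 5 4 second_phase) ?N ((fst u)(4 := I - S), snd u) ?Q"
    if u: "feasible (fst u 0)" "f (fst s 0) \<le> f (fst u 0)" "f S \<le> f (fst u 0)"
      "f (U S) \<le> f (fst u 0)" "fst u 3 = S" and S: "good_greedy I a S" for S and u :: "'a state"
  proof -
    let ?u = "((fst u)(4 := I - S), snd u)"
    \<comment> \<open>Every starting item already tried has a witness \<open>T\<close>; it stays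
      valid because the value of register 0 never decreases.\<close>
    define J where "J A t \<longleftrightarrow> improved ?u t \<and>
      (\<forall>b\<in>(I - S) - A. \<exists>T. good_greedy (I - S) b T \<and> f T \<le> f (fst t 0))"
      for A and t :: "'a state"
    have "runs E (foreach 5 4 second_phase) (card (fst ?u 4) * ((greedy_time + 4) + 3) + 1) ?u (J {})"
    proof (rule runs_foreach)
      show "J (fst ?u 4) ?u" by (auto simp: J_def improved_def)
    next
      fix A b and t :: "'a state"
      assume A: "A \<subseteq> fst ?u 4" "b \<in> A" and J: "J A t"
        and fr: "\<And>k. k \<notin> writes (foreach 5 4 second_phase) \<Longrightarrow> fst t k = fst ?u k"
      let ?t = "((fst t)(5 := {b}, 4 := A - {b}), snd t)"
      have t3: "fst ?t 3 = S" using fr[of 3] u by simp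
      have "runs E second_phase (greedy_time + 4) ?t (\<lambda>v. improved ?t v \<and>
        (\<exists>T. good_greedy (I - fst ?t 3) b T \<and> f T \<le> f (fst v 0)))"
        by (rule runs_second_phase) (use A t3 in auto)
      then show "runs E second_phase (greedy_time + 4) ?t (J (A - {b}))"
      proof (rule runs_mono[OF _ order_refl])
        fix v :: "'a state"
        assume v: "improved ?t v \<and>
          (\<exists>T. good_greedy (I - fst ?t 3) b T \<and> f T \<le> f (fst v 0))"
        have "\<exists>T. good_greedy (I - S) b' T \<and> f T \<le> f (fst v 0)"
          if "b' \<in> (I - S) - (A - {b})" for b'
        proof (cases "b' = b")
          case True
          then show ?thesis using v t3 by auto
        next
          case False
          then have "b' \<in> (I - S) - A" using that by blast
          moreover have "\<forall>b\<in>(I - S) - A. \<exists>T. good_greedy (I - S) b T \<and> f T \<le> f (fst t 0)"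
            using J unfolding J_def by (rule conjunct2)
          ultimately obtain T where "good_greedy (I - S) b' T" "f T \<le> f (fst t 0)" by fast
          then show ?thesis using v by (auto simp: improved_def)
        qed
        then show "J (A - {b}) v" using v J by (auto simp: J_def improved_def)
      qed
    qed (use fin in auto)
    then show ?thesis
    proof (rule runs_mono)
      have "card (I - S) \<le> card I" using fin by (intro card_mono) auto
      then have "card (I - S) * (greedy_time + 7) \<le> card I * (greedy_time + 7)"
        by (rule mult_right_mono) simp
      then show "card (fst ?u 4) * ((greedy_time + 4) + 3) + 1 \<le> ?N" by (simp add: algebra_simps)
    next
      fix t :: "'a state"
      assume J: "J {} t"
      then have t: "feasible (fst t 0)" "f (fst u 0) \<le> f (fst t 0)"
        using u by (auto simp: J_def improved_def)
      \<comment> \<open>\<open>combine\<close> is used with \<open>r\<close> the value of register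
        0, which by now dominates \<open>S\<close>, \<open>U S\<close> and a greedy set for each
        second starting item.\<close>
      then have "f C \<le> (4 + \<alpha>) * f (fst t 0)" if "feasible C" "top_item a C" for C
        using that J S u by (intro combine[of a S]) (auto simp: J_def feasible_def intro: nonneg)
      then show "?Q t" using t u by (auto simp: improved_def)
    qed
  qed
  let ?rest = "Seq (SetAssign 4 (Diff Items (SReg 3))) (foreach 5 4 second_phase)"
  have rest: "runs E (Seq (keep (SReg 3)) (Seq (keep (Unc (SReg 3))) ?rest)) (2 + (2 + (?N + 1)))
      ((fst t)(3 := fst t 9), snd t) ?Q"
    if t: "good_greedy I a (fst t 9)" "fst t 0 = fst s 0" for t :: "'a state"
  proof -
    let ?S = "fst t 9"
    let ?t = "((fst t)(3 := ?S), snd t)"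
    have S: "feasible ?S" using t by (simp add: good_greedy_def feasible_def)
    have US: "feasible (U ?S)"
      using S unc[of ?S] cost_mono[of "U ?S" ?S] by (auto simp: feasible_def)
    show ?thesis
    proof (rule runs_Seq, rule runs_mono[OF runs_frame[OF runs_keep] order_refl])
      fix v :: "'a state"
      assume v: "((fst v 0 = fst ?t 0 \<or> fst v 0 = seval E ?t (SReg 3)) \<and>
        f (fst ?t 0) \<le> f (fst v 0) \<and> f (seval E ?t (SReg 3)) \<le> f (fst v 0)) \<and>
        (\<forall>k. k \<notin> writes (keep (SReg 3)) \<longrightarrow> fst v k = fst ?t k)"
      have v3: "fst v 3 = ?S" using v by simp
      have v0: "feasible (fst v 0)" "f (fst s 0) \<le> f (fst v 0)" "f ?S \<le> f (fst v 0)"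
        using v R S t by auto
      show "runs E (Seq (keep (Unc (SReg 3))) ?rest) (2 + (?N + 1)) v ?Q"
      proof (rule runs_Seq, rule runs_mono[OF runs_frame[OF runs_keep] order_refl])
        fix u :: "'a state"
        assume u: "((fst u 0 = fst v 0 \<or> fst u 0 = seval E v (Unc (SReg 3))) \<and>
          f (fst v 0) \<le> f (fst u 0) \<and> f (seval E v (Unc (SReg 3))) \<le> f (fst u 0)) \<and>
          (\<forall>k. k \<notin> writes (keep (Unc (SReg 3))) \<longrightarrow> fst u k = fst v k)"
        have u3: "fst u 3 = ?S" using u v3 by simp
        have "runs E (foreach 5 4 second_phase) ?N ((fst u)(4 := I - ?S), snd u) ?Q"
          by (rule loop) (use u u3 v0 v3 US t in auto)
        then show "runs E ?rest (?N + 1) u ?Q"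
          using u3 by (intro runs_SetAssign_Seq) simp
      qed
    qed
  qed
  let ?s = "((fst s)(7 := I, 8 := {a}), snd s)"
  have "runs E greedy greedy_time ?s (\<lambda>t. good_greedy (fst ?s 7) a (fst t 9))"
    using a by (intro runs_greedy) auto
  from runs_frame[OF this] have "runs E greedy greedy_time ?s
    (\<lambda>t. runs E (Seq (SetAssign 3 (SReg 9)) (Seq (keep (SReg 3)) (Seq (keep (Unc (SReg 3))) ?rest)))
      (2 + (2 + (?N + 1)) + 1) t ?Q)"
    by (rule runs_mono[OF _ order_refl], intro runs_SetAssign_Seq) (use rest in simp)
  from runs_Seq[OF this] have "runs E first_phase (greedy_time + (2 + (2 + (?N + 1)) + 1) + 1 + 1) s ?Q"
    unfolding first_phase_def using a by (intro runs_SetAssign_Seq) simp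
  then show ?thesis by (rule runs_mono) (simp_all add: first_phase_time_def)
qed

section \<open>The whole program and its guarantee\<close>

lemma runs_knapsack_prog:
  "runs E knapsack_prog (card I * (first_phase_time + 3) + 2) (\<lambda>_. {}, \<lambda>_. 0)
    (\<lambda>t. feasible (fst t 0) \<and> (\<forall>C. feasible C \<longrightarrow> f C \<le> (4 + \<alpha>) * f (fst t 0)))"
proof -
  let ?s = "((\<lambda>_. {})(1 := I), \<lambda>_. 0) :: 'a state"
  define J where "J A t \<longleftrightarrow> feasible (fst t 0) \<and> (\<forall>a\<in>I - A. \<forall>C. feasible C \<longrightarrow> top_item a C \<longrightarrow>
      f C \<le> (4 + \<alpha>) * f (fst t 0))" for A and t :: "'a state"
  have "runs E (foreach 2 1 first_phase) (card (fst ?s 1) * (first_phase_time + 3) + 1) ?s (J {})"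
  proof (rule runs_foreach)
    \<comment> \<open>Register 0 starts empty, which is feasible because \<open>B\<close> is
      nonnegative.\<close>
    show "J (fst ?s 1) ?s" using B by (simp add: J_def feasible_def cost_def)
  next
    fix A a and t :: "'a state"
    assume A: "A \<subseteq> fst ?s 1" "a \<in> A" and J: "J A t"
    have feas: "feasible (fst t 0)" using J by (simp add: J_def)
    let ?t = "((fst t)(2 := {a}, 1 := A - {a}), snd t)"
    have "runs E first_phase first_phase_time ?t (\<lambda>u. improved ?t u \<and>
      (\<forall>C. feasible C \<longrightarrow> top_item a C \<longrightarrow> f C \<le> (4 + \<alpha>) * f (fst u 0)))"
      by (rule runs_first_phase) (use A feas in auto)
    then show "runs E first_phase first_phase_time ?t (J (A - {a}))"
    proof (rule runs_mono[OF _ order_refl])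
      fix u :: "'a state"
      assume u: "improved ?t u \<and>
        (\<forall>C. feasible C \<longrightarrow> top_item a C \<longrightarrow> f C \<le> (4 + \<alpha>) * f (fst u 0))"
      have "(4 + \<alpha>) * f (fst t 0) \<le> (4 + \<alpha>) * f (fst u 0)"
        using u \<alpha> by (intro mult_left_mono) (auto simp: improved_def)
      then have "f C \<le> (4 + \<alpha>) * f (fst u 0)"
        if "a' \<in> I - (A - {a})" "feasible C" "top_item a' C" for a' C
      proof (cases "a' = a")
        case True
        then show ?thesis using u that by blast
      next
        case False
        then have "f C \<le> (4 + \<alpha>) * f (fst t 0)" using J that unfolding J_def by blast
        then show ?thesis using \<open>(4 + \<alpha>) * f (fst t 0) \<le> (4 + \<alpha>) * f (fst u 0)\<close> by linarith
      qed
      moreover have "feasible (fst u 0)" using u feas by (simp add: improved_def)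
      ultimately show "J (A - {a}) u" unfolding J_def by blast
    qed
  qed (use fin in auto)
  then have "runs E knapsack_prog (card I * (first_phase_time + 3) + 1 + 1) (\<lambda>_. {}, \<lambda>_. 0) (J {})"
    unfolding knapsack_prog_def by (intro runs_SetAssign_Seq) simp
  then show ?thesis
  proof (rule runs_mono)
    fix t :: "'a state"
    assume J: "J {} t"
    then have feas: "feasible (fst t 0)" by (simp add: J_def)
    then have "f (fst t 0) \<ge> 0" by (intro nonneg) (simp add: feasible_def)
    then have ge0: "(4 + \<alpha>) * f (fst t 0) \<ge> 0" using \<alpha> by simp
    have "f C \<le> (4 + \<alpha>) * f (fst t 0)" if C: "feasible C" for C
    \<comment> \<open>The empty set has no top item, so no choice of \<open>a\<close> covers
      it.\<close>
    proof (cases "C = {}")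
      case True
      then show ?thesis using ge0 by (simp add: f_empty)
    next
      case False
      then obtain a where a: "top_item a C" using ex_top_item C by (auto simp: feasible_def)
      then have "a \<in> I" using C by (auto simp: top_item_def feasible_def)
      then show ?thesis using J C a unfolding J_def by blast
    qed
    then show "feasible (fst t 0) \<and> (\<forall>C. feasible C \<longrightarrow> f C \<le> (4 + \<alpha>) * f (fst t 0))"
      using feas by blast
  qed simp
qed

lemma feasible_sets_iff: "S \<in> feasible_sets I c B \<longleftrightarrow> feasible S"
  by (simp add: feasible_sets_def feasible_def cost_def)

lemma knapsack_prog_correct:
  "\<exists>n S. halts_with E knapsack_prog n S \<and> n \<le> card I * (first_phase_time + 3) + 2 \<and>
    S \<in> feasible_sets I c B \<and> f S \<ge> 1 / (4 + \<alpha>) * Max (f ` feasible_sets I c B)"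
proof -
  obtain n t where t: "exec E knapsack_prog (\<lambda>_. {}, \<lambda>_. 0) n t"
    "n \<le> card I * (first_phase_time + 3) + 2" "feasible (fst t 0)"
    "\<And>C. feasible C \<Longrightarrow> f C \<le> (4 + \<alpha>) * f (fst t 0)"
    using runs_knapsack_prog unfolding runs_def by blast
  have "feasible_sets I c B \<subseteq> Pow I" by (auto simp: feasible_sets_def)
  then have "finite (feasible_sets I c B)" using fin finite_subset by blast
  then have "Max (f ` feasible_sets I c B) \<le> (4 + \<alpha>) * f (fst t 0)"
    using t(3,4) by (subst Max_le_iff) (auto simp: feasible_sets_iff)
  then have "1 / (4 + \<alpha>) * Max (f ` feasible_sets I c B) \<le> f (fst t 0)"
    using \<alpha> by (simp add: field_simps)
  then show ?thesis using t unfolding halts_with_def feasible_sets_iff by blast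
qed

end

theorem theorem4:
  fixes \<alpha> :: real
  assumes "\<alpha> \<ge> 1"
  shows "\<exists>(p :: prog) (q :: nat poly).
    \<forall>(I :: 'a::linorder set) (c :: 'a \<Rightarrow> nat) (B :: real) (f :: 'a set \<Rightarrow> real)
      (U :: 'a set \<Rightarrow> 'a set).
      finite I \<longrightarrow> B \<ge> 0 \<longrightarrow>
      (\<forall>S \<subseteq> I. f S \<ge> 0) \<longrightarrow> submodular_on I f \<longrightarrow> f {} = 0 \<longrightarrow>
      unconstrained_approx \<alpha> I f U \<longrightarrow>
      (\<exists>n S. halts_with \<lparr>items = I, size_of = c, capacity = B, val_oracle = f, unc_oracle = U\<rparr> p n S \<and>
        n \<le> poly q (card I) \<and>
        S \<in> feasible_sets I c B \<and>
        f S \<ge> 1 / (4 + \<alpha>) * Max (f ` feasible_sets I c B))"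
proof -
  \<comment> \<open>The time bounds are rebuilt as polynomials in \<open>card I\<close>:
    \<open>g\<close> is \<open>greedy_time\<close>, and the bracket in \<open>q\<close> is
    \<open>first_phase_time + 3\<close>. The degree is four.\<close>
  define x :: "nat poly" where "x = [:0, 1:]"
  define g where "g = x * ([:5:] * x + [:5:]) + [:3:]"
  define q where "q = x * (x * (g + [:7:]) + g + [:9:] + [:3:]) + [:2:]"
  show ?thesis
  proof (intro exI[of _ knapsack_prog] exI[of _ q] allI impI)
    fix I :: "'a set" and c :: "'a \<Rightarrow> nat" and B :: real and f :: "'a set \<Rightarrow> real"
      and U :: "'a set \<Rightarrow> 'a set"
    assume "finite I" "B \<ge> 0" "\<forall>S \<subseteq> I. f S \<ge> 0" "submodular_on I f" "f {} = 0"
      "unconstrained_approx \<alpha> I f U"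
    then interpret knapsack I c B f U \<alpha> by unfold_locales (use assms in auto)
    have "poly q (card I) = card I * (first_phase_time + 3) + 2"
      by (simp add: q_def g_def x_def first_phase_time_def greedy_time_def algebra_simps)
    then show "\<exists>n S. halts_with E knapsack_prog n S \<and> n \<le> poly q (card I) \<and>
        S \<in> feasible_sets I c B \<and> f S \<ge> 1 / (4 + \<alpha>) * Max (f ` feasible_sets I c B)"
      using knapsack_prog_correct by simp
  qed
qed

end
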